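(* Let $S$ be an Arf numerical semigroup with multiplicity $5$ and conductor $c$. (i) If $c\equiv 0\pmod 5$, then either $S=\langle 5,c-2,c+1,c+2,c+4\rangle$ or $S=\langle 5,c+1,c+2,c+3,c+4\rangle$. (ii) If $c\equiv 2\pmod 5$, then $S=\langle 5,c,c+1,c+2,c+4\rangle$. (iii) If $c\equiv 3\pmod 5$, then $S=\langle 5,c,c+1,c+3,c+4\rangle$. (iv) If $c\equiv 4\pmod 5$, then either $S=\langle 5,c-2,c,c+2,c+4\rangle$ or $S=\langle 5,c,c+2,c+3,c+4\rangle$.
   Context: A numerical semigroup is a submonoid $S$ of $(\mathbb N,+)$ ($\mathbb N$ the nonnegative integers) with finite complement in $\mathbb N$. Its multiplicity is the least positive integer in $S$, and its conductor is $\max(\mathbb Z\setminus S)+1$. $S$ is an Arf numerical semigroup if $x+y-z\in S$ for all $x,y,z\in S$ with $x\ge y\ge z$. $\langle A\rangle$ denotes the submonoid of $\mathbb N$ generated by $A$. *)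

theory Defs
  imports "HOL.Hull" "HOL-Number_Theory.Cong"
begin

definition nat_submonoid :: "nat set \<Rightarrow> bool" where
  "nat_submonoid S \<longleftrightarrow> 0 \<in> S \<and> (\<forall>x\<in>S. \<forall>y\<in>S. x + y \<in> S)"

definition generated :: "nat set \<Rightarrow> nat set" where
  "generated A = nat_submonoid hull A"

definition numerical_semigroup :: "nat set \<Rightarrow> bool" where
  "numerical_semigroup S \<longleftrightarrow> nat_submonoid S \<and> finite (- S)"

definition multiplicity_of :: "nat set \<Rightarrow> nat" where
  "multiplicity_of S = (LEAST n. n \<in> S \<and> 0 < n)"

text \<open>The complement is taken in the integers, so it contains all negative integers and is
  never empty; in particular the conductor of the full semigroup is 0. The complement is
  infinite but bounded above for a numerical semigroup, so the maximum is written with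
  \<^term>\<open>Greatest\<close> and not with \<^term>\<open>Max\<close>.\<close>

definition conductor :: "nat set \<Rightarrow> int" where
  "conductor S = (GREATEST n. n \<notin> int ` S) + 1"

text \<open>The subtraction on the natural numbers is exact because of \<^prop>\<open>z \<le> y\<close>.\<close>

definition arf_numerical_semigroup :: "nat set \<Rightarrow> bool" where
  "arf_numerical_semigroup S \<longleftrightarrow> numerical_semigroup S \<and>
     (\<forall>x\<in>S. \<forall>y\<in>S. \<forall>z\<in>S. z \<le> y \<and> y \<le> x \<longrightarrow> x + y - z \<in> S)"

lemma nat_submonoid_generated: "nat_submonoid (generated A)"
  by (auto simp: generated_def hull_def nat_submonoid_def)

lemma conductor_le_imp_mem:
  assumes "numerical_semigroup S" and "conductor S \<le> int n"
  shows "n \<in> S"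
proof (rule ccontr)
  assume n: "n \<notin> S"
  have fin: "finite (- S)" using assms(1) by (simp add: numerical_semigroup_def)
  have bound: "m \<le> int (Max (- S))" if "m \<notin> int ` S" for m
  proof (cases "0 \<le> m")
    case True
    then have "nat m \<in> - S" using that by (metis ComplI image_eqI int_nat_eq)
    then have "nat m \<le> Max (- S)" using fin by simp
    then show ?thesis using True by linarith
  qed simp
  have "Max (- S) \<in> - S" using fin n by (intro Max_in) auto
  then have "int (Max (- S)) \<notin> int ` S" by auto
  then have "(GREATEST m. m \<notin> int ` S) = int (Max (- S))"
    using bound by (intro Greatest_equality) auto
  moreover have "int n \<le> int (Max (- S))" using n by (intro bound) auto
  ultimately show False using assms(2) by (simp add: conductor_def)
qed

text \<open>Multiplicity 5 forces the conductor to be at least 5, so that natural number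
  differences such as c - 2 are not truncated.\<close>

lemma conductor_ge_5:
  assumes "numerical_semigroup S" and "multiplicity_of S = 5"
  shows "5 \<le> conductor S"
proof (rule ccontr)
  assume "\<not> 5 \<le> conductor S"
  then have "4 \<in> S" using assms(1) by (intro conductor_le_imp_mem) auto
  then have "multiplicity_of S \<le> 4"
    unfolding multiplicity_of_def by (intro Least_le) auto
  then show False using assms(2) by simp
qed

end

theory Submission imports Defs begin

text \<open>The gap \<open>c - 1\<close> forces every smaller number of its residue class modulo 5 to be a
  gap. Applying the Arf condition to \<open>5 * q + r\<close> and the neighbouring multiples of 5 yields
  \<open>5 * q + 2 * r\<close> and \<open>5 * q + 10 - r\<close>, so an element of \<open>S\<close> below \<open>c\<close> that is not a multiple
  of 5 soon produces an element of the class of \<open>c - 1\<close>. Only \<open>c - 2\<close> can escape, because there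
  the element produced lies beyond \<open>c - 1\<close>.\<close>

section \<open>Submonoids of the naturals and their residue classes\<close>

lemma nat_submonoid_add_mult:
  assumes "nat_submonoid S" "m \<in> S" "x \<in> S"
  shows "x + m * j \<in> S"
proof (induction j)
  case (Suc j)
  then have "(x + m * j) + m \<in> S" using assms unfolding nat_submonoid_def by blast
  then show ?case by (simp add: algebra_simps)
qed (use assms in simp)

lemma nat_submonoid_mult:
  assumes "nat_submonoid S" "m \<in> S"
  shows "m * j \<in> S"
  using nat_submonoid_add_mult[OF assms, of 0 j] assms by (simp add: nat_submonoid_def)

lemma nat_submonoid_mod_class:
  fixes x :: nat
  assumes "nat_submonoid S" "m \<in> S" "g \<in> S" "g \<le> x" "g mod m = x mod m"
  shows "x \<in> S"
proof -
  have "m dvd x - g" using assms(4,5) by (metis mod_eq_dvd_iff_nat)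
  then obtain j where "x - g = m * j" by (elim dvdE)
  then have "x = g + m * j" using assms(4) by simp
  then show ?thesis using nat_submonoid_add_mult[OF assms(1-3)] by simp
qed

text \<open>Adding multiples of \<open>m\<close> to a generator \<open>g\<close> reaches every
  larger number of its class modulo \<open>m\<close>. It therefore suffices that each element of
  \<open>S\<close> outside the zero class has a generator of its own class at or below it.\<close>

lemma generated_eqI:
  assumes S: "nat_submonoid S" and A: "A \<subseteq> S" and m: "m \<in> A"
    and cover: "\<And>x. x \<in> S \<Longrightarrow> m dvd x \<or> (\<exists>g\<in>A. g \<le> x \<and> g mod m = x mod m)"
  shows "S = generated A"
proof
  show "generated A \<subseteq> S" unfolding generated_def using A S by (rule hull_minimal)
next
  have sub: "A \<subseteq> generated A" unfolding generated_def by (rule hull_subset)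
  note mon = nat_submonoid_generated[of A]
  have m': "m \<in> generated A" using sub m by blast
  show "S \<subseteq> generated A"
  proof
    fix x assume "x \<in> S"
    from cover[OF this] show "x \<in> generated A"
    proof
      assume "m dvd x"
      then show ?thesis using nat_submonoid_mult[OF mon m'] by (auto elim: dvdE)
    next
      assume "\<exists>g\<in>A. g \<le> x \<and> g mod m = x mod m"
      then show ?thesis using nat_submonoid_mod_class[OF mon m'] sub by blast
    qed
  qed
qed

section \<open>Multiplicity and conductor as an element and a gap\<close>

lemma multiplicity_of_mem:
  assumes "numerical_semigroup S"
  shows "multiplicity_of S \<in> S"
proof -
  have "infinite S" using assms finite_compl unfolding numerical_semigroup_def by auto
  then have "\<not> S \<subseteq> {0}" using finite_subset by blast
  then have "\<exists>n. n \<in> S \<and> 0 < n" by auto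
  then show ?thesis unfolding multiplicity_of_def by (rule LeastI2_ex) simp
qed

text \<open>The \<open>GREATEST\<close> in the conductor says something only once a maximum is known
  to exist. It is \<open>-1\<close> when \<open>S\<close> is everything, and otherwise the maximum
  of the finite complement in the naturals.\<close>

lemma conductor_minus_1_not_mem:
  assumes S: "numerical_semigroup S" and c: "conductor S = int c" "0 < c"
  shows "c - 1 \<notin> S"
proof
  assume mem: "c - 1 \<in> S"
  obtain m :: int where m: "m \<notin> int ` S" "\<And>k. k \<notin> int ` S \<Longrightarrow> k \<le> m"
  proof (cases "- S = {}")
    case True
    have "k \<le> -1" if "k \<notin> int ` S" for k
    proof (rule ccontr)
      assume "\<not> k \<le> -1"
      then have "k = int (nat k)" by simp
      then show False using that True by blast
    qed
    then show thesis by (intro that[of "-1"]) auto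
  next
    case False
    have fin: "finite (- S)" using S by (simp add: numerical_semigroup_def)
    have "k \<le> int (Max (- S))" if "k \<notin> int ` S" for k
    proof (cases "0 \<le> k")
      case True
      then have "nat k \<in> - S" using that by (metis ComplI image_eqI int_nat_eq)
      then have "nat k \<le> Max (- S)" using fin by simp
      then show ?thesis using True by linarith
    qed simp
    moreover have "int (Max (- S)) \<notin> int ` S" using Max_in[OF fin False] by auto
    ultimately show thesis using that by blast
  qed
  have "conductor S = m + 1"
    unfolding conductor_def using m by (subst Greatest_equality[of _ m]) auto
  then have "m = int (c - 1)" using c by simp
  then show False using m(1) mem by blast
qed

section \<open>Consequences of the Arf condition modulo 5\<close>

locale arf5 =
  fixes S :: "nat set"
  assumes arf: "arf_numerical_semigroup S" and five: "5 \<in> S"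
begin

lemma submonoid: "nat_submonoid S"
  using arf by (simp add: arf_numerical_semigroup_def numerical_semigroup_def)

lemma arfD: "\<lbrakk>x \<in> S; y \<in> S; z \<in> S; z \<le> y; y \<le> x\<rbrakk> \<Longrightarrow> x + y - z \<in> S"
  using arf by (simp add: arf_numerical_semigroup_def)

lemmas mult_mem = nat_submonoid_mult[OF submonoid five]
lemmas up = nat_submonoid_mod_class[OF submonoid five]

lemma double_residue: "5 * q + r \<in> S \<Longrightarrow> 5 * q + 2 * r \<in> S"
  using arfD[of "5 * q + r" "5 * q + r" "5 * q"] mult_mem[of q] by (simp add: algebra_simps)

text \<open>This is reflection of \<open>5 * q + r\<close> in \<open>5 * (q + 1)\<close>. The bound
  on \<open>r\<close> supplies the ordering that the Arf condition demands.\<close>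

lemma negate_residue:
  assumes "5 * q + r \<in> S" "r \<le> 5"
  shows "5 * q + (10 - r) \<in> S"
proof -
  have "5 * (q + 1) + 5 * (q + 1) - (5 * q + r) \<in> S"
    using assms by (intro arfD mult_mem) auto
  moreover have "5 * (q + 1) + 5 * (q + 1) - (5 * q + r) = 5 * q + (10 - r)"
    using assms(2) by simp
  ultimately show ?thesis by simp
qed

lemma residue_1:
  assumes "5 * q + 1 \<in> S"
  shows "5 * q + 2 \<in> S" "5 * q + 3 \<in> S" "5 * q + 4 \<in> S"
proof -
  show two: "5 * q + 2 \<in> S" using double_residue[OF assms] by simp
  \<comment> \<open>Doubling produces only the residues 2 and 4; residue 3 is the sum of residues 2
    and 1.\<close>
  show "5 * q + 3 \<in> S" using arfD[OF two assms mult_mem[of q]] by (simp add: algebra_simps)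
  show "5 * q + 4 \<in> S" using double_residue[OF two] by simp
qed

lemma residue_2:
  assumes "5 * q + 2 \<in> S"
  shows "5 * q + 4 \<in> S" "5 * q + 8 \<in> S"
  using double_residue[OF assms] negate_residue[OF assms] by simp_all

lemma residue_3:
  assumes "5 * q + 3 \<in> S"
  shows "5 * q + 6 \<in> S" "5 * q + 7 \<in> S"
  using double_residue[OF assms] negate_residue[OF assms] by simp_all

lemma residue_4:
  assumes "5 * q + 4 \<in> S"
  shows "5 * q + 6 \<in> S" "5 * q + 7 \<in> S" "5 * q + 8 \<in> S"
proof -
  show six: "5 * q + 6 \<in> S" using negate_residue[OF assms] by simp
  \<comment> \<open>The number \<open>5 * q + 6\<close> has residue 1 in the next block of
    five.\<close>
  show "5 * q + 7 \<in> S" using residue_1(1)[of "q + 1"] six by (simp add: algebra_simps)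
  show "5 * q + 8 \<in> S" using double_residue[OF assms] by simp
qed

lemma gap_down:
  assumes "g \<notin> S" "x \<le> g" "x mod 5 = g mod 5"
  shows "x \<notin> S"
  using up assms by blast

text \<open>Every class \<open>x mod 5\<close> other than 0 forces an element \<open>x + d\<close>
  in the class of \<open>c - 1\<close>. If \<open>d \<le> 4\<close>, then \<open>x < c\<close> and
  the congruence already give \<open>x + d \<le> c - 1\<close>, a contradiction. If
  \<open>d = 6\<close>, then \<open>x\<close> is congruent to \<open>c - 2\<close>, and the bound
  fails only for \<open>x = c - 2\<close> itself.\<close>

lemma small_elements:
  assumes gap: "c - 1 \<notin> S" and x: "x \<in> S" "x < c"
    and c: "c mod 5 \<noteq> 1"
  shows "5 dvd x \<or> x = c - 2 \<and> (c mod 5 = 0 \<or> c mod 5 = 4)"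
proof (rule ccontr)
  assume neg: "\<not> ?thesis"
  define q where "q = x div 5"
  define k where "k = c div 5"
  have xq: "x = 5 * q + x mod 5" and ck: "c = 5 * k + c mod 5"
    by (simp_all add: q_def k_def)
  have qk: "q \<le> k" unfolding q_def k_def using x(2) by (intro div_le_mono) simp
  \<comment> \<open>Here \<open>res\<close> says that \<open>x + d\<close> lies in the class of
    \<open>c - 1\<close>, shifted by one to avoid subtraction, and \<open>less\<close> keeps it
    below \<open>c\<close>. In block coordinates both become arithmetic on \<open>q\<close>,
    \<open>k\<close> and numerals.\<close>
  have no: "x + d \<notin> S"
    if r: "x mod 5 = r" and s: "c mod 5 = s"
      and less: "5 * q + r < 5 * k + s \<Longrightarrow> 5 * q + r + d < 5 * k + s"
      and res: "(r + d + 1) mod 5 = s" for r s d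
  proof (rule gap_down[OF gap])
    have x': "x = 5 * q + r" and c': "c = 5 * k + s" using xq ck r s by simp_all
    then have "x + d < c" using less x(2) by simp
    then show "x + d \<le> c - 1" by simp
    have "x + d + 1 = 5 * q + (r + d + 1)" using x' by simp
    then have "(x + d + 1) mod 5 = (r + d + 1) mod 5" by (simp only: mod_mult_self4)
    then have "(x + d + 1) mod 5 = (c - 1 + 1) mod 5" using res s x(2) by simp
    then show "(x + d) mod 5 = (c - 1) mod 5" by (simp add: mod_Suc split: if_splits)
  qed
  have "x mod 5 < 5" by simp
  moreover have "x mod 5 \<noteq> 0" using neg by (simp add: dvd_eq_mod_eq_0)
  ultimately consider "x mod 5 = 1" | "x mod 5 = 2" | "x mod 5 = 3" | "x mod 5 = 4" by linarith
  \<comment> \<open>The three offsets in each row reach the three other nonzero classes, so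
    whichever of them contains \<open>c - 1\<close> is hit.\<close>
  then have forced: "(x mod 5 = 1 \<and> x + 1 \<in> S \<and> x + 2 \<in> S \<and> x + 3 \<in> S) \<or>
      (x mod 5 = 2 \<and> x + 2 \<in> S \<and> x + 4 \<in> S \<and> x + 6 \<in> S) \<or>
      (x mod 5 = 3 \<and> x + 3 \<in> S \<and> x + 4 \<in> S \<and> x + 6 \<in> S) \<or>
      (x mod 5 = 4 \<and> x + 2 \<in> S \<and> x + 3 \<in> S \<and> x + 4 \<in> S)"
  proof cases
    case 1
    then have e: "x = 5 * q + 1" using xq by simp
    then have shift: "x + 1 = 5 * q + 2" "x + 2 = 5 * q + 3" "x + 3 = 5 * q + 4" by simp_all
    have "5 * q + 1 \<in> S" using x(1) e by simp
    from residue_1[OF this] 1 show ?thesis unfolding shift by blast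
  next
    case 2
    then have e: "x = 5 * q + 2" using xq by simp
    then have shift: "x + 2 = 5 * q + 4" "x + 4 = 5 * q + 6" "x + 6 = 5 * q + 8" by simp_all
    have "5 * q + 2 \<in> S" using x(1) e by simp
    note m = residue_2[OF this]
    from m residue_4[OF m(1)] 2 show ?thesis unfolding shift by blast
  next
    case 3
    then have e: "x = 5 * q + 3" using xq by simp
    then have shift: "x + 3 = 5 * q + 6" "x + 4 = 5 * q + 7" "x + 6 = 5 * (q + 1) + 4"
      by simp_all
    have "5 * q + 3 \<in> S" using x(1) e by simp
    note m = residue_3[OF this]
    have "5 * (q + 1) + 2 \<in> S" using m(2) by (simp add: algebra_simps)
    from m residue_2(1)[OF this] 3 show ?thesis unfolding shift by blast
  next
    case 4
    then have e: "x = 5 * q + 4" using xq by simp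
    then have shift: "x + 2 = 5 * q + 6" "x + 3 = 5 * q + 7" "x + 4 = 5 * q + 8" by simp_all
    have "5 * q + 4 \<in> S" using x(1) e by simp
    from residue_4[OF this] 4 show ?thesis unfolding shift by blast
  qed
  have "c mod 5 < 5" by simp
  then consider "c mod 5 = 0" | "c mod 5 = 2" | "c mod 5 = 3" | "c mod 5 = 4"
    using c by linarith
  then show False
  proof cases
    case 1
    \<comment> \<open>Equality would mean \<open>x = 5 * k - 2 = c - 2\<close>, which
      \<open>neg\<close> excludes. This makes room for the offset 6.\<close>
    have ne: "q + 1 \<noteq> k" if "x mod 5 = 3" using neg xq ck that 1 by auto
    have n1: "x + 3 \<notin> S" if "x mod 5 = 1"
      by (rule no[OF that 1]) (use qk in arith, simp)
    have n2: "x + 2 \<notin> S" if "x mod 5 = 2"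
      by (rule no[OF that 1]) (use qk in arith, simp)
    have n3: "x + 6 \<notin> S" if "x mod 5 = 3"
      by (rule no[OF that 1]) (use qk ne[OF that] in arith, simp)
    have n4: "x + 0 \<notin> S" if "x mod 5 = 4"
      by (rule no[OF that 1]) (use qk in arith, simp)
    show False using forced n1 n2 n3 n4 x(1) by auto
  next
    case 2
    have n1: "x + 0 \<notin> S" if "x mod 5 = 1"
      by (rule no[OF that 2]) (use qk in arith, simp)
    have n2: "x + 4 \<notin> S" if "x mod 5 = 2"
      by (rule no[OF that 2]) (use qk in arith, simp)
    have n3: "x + 3 \<notin> S" if "x mod 5 = 3"
      by (rule no[OF that 2]) (use qk in arith, simp)
    have n4: "x + 2 \<notin> S" if "x mod 5 = 4"
      by (rule no[OF that 2]) (use qk in arith, simp)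
    show False using forced n1 n2 n3 n4 x(1) by auto
  next
    case 3
    have n1: "x + 1 \<notin> S" if "x mod 5 = 1"
      by (rule no[OF that 3]) (use qk in arith, simp)
    have n2: "x + 0 \<notin> S" if "x mod 5 = 2"
      by (rule no[OF that 3]) (use qk in arith, simp)
    have n3: "x + 4 \<notin> S" if "x mod 5 = 3"
      by (rule no[OF that 3]) (use qk in arith, simp)
    have n4: "x + 3 \<notin> S" if "x mod 5 = 4"
      by (rule no[OF that 3]) (use qk in arith, simp)
    show False using forced n1 n2 n3 n4 x(1) by auto
  next
    case 4
    \<comment> \<open>Again equality would mean \<open>x = 5 * k + 2 = c - 2\<close>.\<close>
    have ne: "q \<noteq> k" if "x mod 5 = 2" using neg xq ck that 4 by auto
    have n1: "x + 2 \<notin> S" if "x mod 5 = 1"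
      by (rule no[OF that 4]) (use qk in arith, simp)
    have n2: "x + 6 \<notin> S" if "x mod 5 = 2"
      by (rule no[OF that 4]) (use qk ne[OF that] in arith, simp)
    have n3: "x + 0 \<notin> S" if "x mod 5 = 3"
      by (rule no[OF that 4]) (use qk in arith, simp)
    have n4: "x + 4 \<notin> S" if "x mod 5 = 4"
      by (rule no[OF that 4]) (use qk in arith, simp)
    show False using forced n1 n2 n3 n4 x(1) by auto
  qed
qed

text \<open>The window from \<open>c\<close> to \<open>c + 4\<close> meets every class modulo 5, so
  the covering condition above \<open>c\<close> reduces to five checks. Below \<open>c\<close> each
  element is a multiple of 5 or is itself a generator.\<close>

lemma eq_generatedI:
  assumes "A \<subseteq> S" "5 \<in> A"
    and below: "\<And>x. \<lbrakk>x \<in> S; x < c\<rbrakk> \<Longrightarrow> 5 dvd x \<or> x \<in> A"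
    and above: "\<forall>i\<in>{0, 1, 2, 3, 4}. 5 dvd c + i \<or> (\<exists>g\<in>A. g \<le> c + i \<and> g mod 5 = (c + i) mod 5)"
  shows "S = generated A"
proof (rule generated_eqI[OF submonoid assms(1,2)])
  fix x assume x: "x \<in> S"
  show "5 dvd x \<or> (\<exists>g\<in>A. g \<le> x \<and> g mod 5 = x mod 5)"
  proof (cases "x < c")
    case True
    then show ?thesis using below[OF x] by blast
  next
    case False
    define i where "i = (x - c) mod 5"
    have "i \<le> x - c" by (simp add: i_def)
    then have le: "c + i \<le> x" using False by simp
    have "(c + i) mod 5 = (c + (x - c)) mod 5" unfolding i_def by (rule mod_add_right_eq)
    then have eq: "(c + i) mod 5 = x mod 5" using False by simp
    have "i < 5" by (simp add: i_def)
    then have "i \<in> {0, 1, 2, 3, 4}" by auto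
    then show ?thesis using above le eq by (metis dvd_eq_mod_eq_0 order_trans)
  qed
qed

end

section \<open>The generators for each residue of the conductor\<close>

theorem proposition20:
  fixes S :: "nat set" and c :: nat
  assumes "arf_numerical_semigroup S"
    and "multiplicity_of S = 5"
    and "conductor S = int c"
  shows "([c = 0] (mod 5) \<longrightarrow>
            S = generated {5, c - 2, c + 1, c + 2, c + 4} \<or>
            S = generated {5, c + 1, c + 2, c + 3, c + 4}) \<and>
         ([c = 2] (mod 5) \<longrightarrow>
            S = generated {5, c, c + 1, c + 2, c + 4}) \<and>
         ([c = 3] (mod 5) \<longrightarrow>
            S = generated {5, c, c + 1, c + 3, c + 4}) \<and>
         ([c = 4] (mod 5) \<longrightarrow>
            S = generated {5, c - 2, c, c + 2, c + 4} \<or>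
            S = generated {5, c, c + 2, c + 3, c + 4})"
proof -
  have sg: "numerical_semigroup S"
    using assms(1) by (simp add: arf_numerical_semigroup_def)
  interpret arf5 S
    using assms(1) multiplicity_of_mem[OF sg] assms(2) by unfold_locales simp_all
  have c5: "5 \<le> c" using conductor_ge_5[OF sg assms(2)] assms(3) by simp
  have gap: "c - 1 \<notin> S" using conductor_minus_1_not_mem[OF sg assms(3)] c5 by simp
  have big: "n \<in> S" if "c \<le> n" for n
    using that assms(3) by (intro conductor_le_imp_mem[OF sg]) simp
  note small = small_elements[OF gap]
  \<comment> \<open>Since \<open>5 \<le> c\<close>, one block of five can be split off explicitly;
    after rewriting \<open>c\<close> in terms of \<open>j\<close>, the simplifier evaluates
    \<open>c - 2\<close> without truncation.\<close>
  define j where "j = c div 5 - 1"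
  have c: "c = 5 * j + 5 + c mod 5"
    using c5 by (simp add: j_def div_le_mono[of 5 c 5, simplified] algebra_simps)
  show ?thesis
  proof (intro conjI impI)
    assume "[c = 0] (mod 5)"
    then have m: "c mod 5 = 0" by (simp add: cong_def)
    have e: "c = 5 * j + 5" using c m by simp
    show "S = generated {5, c - 2, c + 1, c + 2, c + 4} \<or>
          S = generated {5, c + 1, c + 2, c + 3, c + 4}"
    \<comment> \<open>Only \<open>c - 2\<close> can be a non-multiple of 5 below \<open>c\<close>.
      If present, it serves the class of \<open>c + 3\<close> and replaces that generator.\<close>
    proof (cases "c - 2 \<in> S")
      case True
      have "S = generated {5, c - 2, c + 1, c + 2, c + 4}"
      proof (rule eq_generatedI[where c = c])
        show "5 dvd x \<or> x \<in> {5, c - 2, c + 1, c + 2, c + 4}" if "x \<in> S" "x < c" for x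
          using small[OF that] m by auto
      qed (use True big five in \<open>simp_all add: e\<close>)
      then show ?thesis ..
    next
      case False
      have "S = generated {5, c + 1, c + 2, c + 3, c + 4}"
      proof (rule eq_generatedI[where c = c])
        show "5 dvd x \<or> x \<in> {5, c + 1, c + 2, c + 3, c + 4}" if "x \<in> S" "x < c" for x
          using small[OF that] m that(1) False by auto
      qed (use big five in \<open>simp_all add: e\<close>)
      then show ?thesis ..
    qed
  next
    assume "[c = 2] (mod 5)"
    then have m: "c mod 5 = 2" by (simp add: cong_def)
    have e: "c = 5 * j + 7" using c m by simp
    show "S = generated {5, c, c + 1, c + 2, c + 4}"
    \<comment> \<open>Below \<open>c\<close> only multiples of 5 remain, and \<open>c + 3\<close> is
      the multiple of 5 left out of the window.\<close>
    proof (rule eq_generatedI[where c = c])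
      show "5 dvd x \<or> x \<in> {5, c, c + 1, c + 2, c + 4}" if "x \<in> S" "x < c" for x
        using small[OF that] m by auto
    qed (use big five in \<open>simp_all add: e\<close>)
  next
    assume "[c = 3] (mod 5)"
    then have m: "c mod 5 = 3" by (simp add: cong_def)
    have e: "c = 5 * j + 8" using c m by simp
    show "S = generated {5, c, c + 1, c + 3, c + 4}"
    proof (rule eq_generatedI[where c = c])
      show "5 dvd x \<or> x \<in> {5, c, c + 1, c + 3, c + 4}" if "x \<in> S" "x < c" for x
        using small[OF that] m by auto
    qed (use big five in \<open>simp_all add: e\<close>)
  next
    assume "[c = 4] (mod 5)"
    then have m: "c mod 5 = 4" by (simp add: cong_def)
    have e: "c = 5 * j + 9" using c m by simp
    show "S = generated {5, c - 2, c, c + 2, c + 4} \<or>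
          S = generated {5, c, c + 2, c + 3, c + 4}"
    proof (cases "c - 2 \<in> S")
      case True
      have "S = generated {5, c - 2, c, c + 2, c + 4}"
      proof (rule eq_generatedI[where c = c])
        show "5 dvd x \<or> x \<in> {5, c - 2, c, c + 2, c + 4}" if "x \<in> S" "x < c" for x
          using small[OF that] m by auto
      qed (use True big five in \<open>simp_all add: e\<close>)
      then show ?thesis ..
    next
      case False
      have "S = generated {5, c, c + 2, c + 3, c + 4}"
      proof (rule eq_generatedI[where c = c])
        show "5 dvd x \<or> x \<in> {5, c, c + 2, c + 3, c + 4}" if "x \<in> S" "x < c" for x
          using small[OF that] m that(1) False by auto
      qed (use big five in \<open>simp_all add: e\<close>)
      then show ?thesis ..
    qed
  qed
qed

end
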